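(* Let $G$ be a complete multipartite graph with distinct maximal partite sets $I_1, I_2, \dots, I_r$ satisfying $|I_1| > |I_2| \geq \dots \geq |I_r|$. Let $k \geq 3$ be an integer and $m \geq k\,\alpha_k(G)$ an integer. Let $w$ and $w'$ be $m$-weightings of $G$ such that $w$ is uniform-$\alpha$ and $w'$ is uniform on a largest $k$-clique independent set of $G$. Then $\pi_k(G(w)) < \pi_k(G(w'))$.
   Context: All graphs are simple. $\mathbb{N}_0 = \{0,1,2,\dots\}$. For a graph $G$, a function $w: V(G) \to \mathbb{N}_0$ with $\sum_{v \in V(G)} w(v) = m$ is an $m$-weighting of $G$. $G(w)$ is the graph obtained from $G$ by replacing each vertex $v$ by a clique $K^v$ on $w(v)$ vertices and joining every vertex of $K^u$ to every vertex of $K^v$ whenever $uv \in E(G)$. $\pi_k(H)$ denotes the number of $k$-cliques of a graph $H$. A subset $I \subseteq V(G)$ is a $k$-clique independent set if no $k$ vertices of $I$ induce a $k$-clique of $G$; $\alpha_k(G)$ is the maximum size of a $k$-clique independent set. An $m$-weighting $w$ is uniform on $U \subseteq V(G)$ if $w(v)=0$ for all $v \notin U$ and $w(u) \in \{\lfloor m/|U|\rfloor, \lceil m/|U| \rceil\}$ for all $u \in U$; $w$ is uniform-$\alpha$ if it is uniform on some independent set of $G$ of maximum size. A complete multipartite graph is a graph whose vertex set is the union of pairwise disjoint non-empty sets $I_1,\dots,I_r$ (its maximal partite sets), with $xy$ an edge iff $x$ and $y$ lie in different sets. *)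

theory Defs
  imports Complex_Main "HOL-Library.Ramsey"
begin

text \<open>
  A graph is a pair of a vertex set and a set of two-element vertex sets. The predicates
  \<^const>\<open>clique\<close> and \<^const>\<open>indep\<close> on such edge sets are those of \<^theory>\<open>HOL-Library.Ramsey\<close>.
\<close>

type_synonym 'a graph = "'a set \<times> 'a set set"

abbreviation verts :: "'a graph \<Rightarrow> 'a set" where
  "verts \<equiv> fst"

abbreviation edges :: "'a graph \<Rightarrow> 'a set set" where
  "edges \<equiv> snd"

definition simple_graph :: "'a graph \<Rightarrow> bool" where
  "simple_graph G \<longleftrightarrow> finite (verts G) \<and> edges G \<subseteq> [verts G]\<^bsup>2\<^esup>"

definition num_cliques :: "nat \<Rightarrow> 'a graph \<Rightarrow> nat" where
  "num_cliques k G = card {K. K \<subseteq> verts G \<and> card K = k \<and> clique K (edges G)}"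

text \<open>Only the values of a weighting on the vertices of the graph are relevant.\<close>

definition weighting :: "'a graph \<Rightarrow> nat \<Rightarrow> ('a \<Rightarrow> nat) \<Rightarrow> bool" where
  "weighting G m w \<longleftrightarrow> (\<Sum>v\<in>verts G. w v) = m"

text \<open>The clique replacing a vertex \<open>v\<close> has the vertices \<open>(v, 0), \<dots>, (v, w v - 1)\<close>.\<close>

definition blowup :: "'a graph \<Rightarrow> ('a \<Rightarrow> nat) \<Rightarrow> ('a \<times> nat) graph" where
  "blowup G w =
    (let V = (SIGMA v:verts G. {..<w v})
     in (V, {{x, y} | x y. x \<in> V \<and> y \<in> V \<and> x \<noteq> y \<and>
               (fst x = fst y \<or> {fst x, fst y} \<in> edges G)}))"

definition clique_independent :: "nat \<Rightarrow> 'a graph \<Rightarrow> 'a set \<Rightarrow> bool" where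
  "clique_independent k G S \<longleftrightarrow>
    S \<subseteq> verts G \<and> \<not> (\<exists>K. K \<subseteq> S \<and> card K = k \<and> clique K (edges G))"

definition clique_independence_number :: "nat \<Rightarrow> 'a graph \<Rightarrow> nat" where
  "clique_independence_number k G = Max (card ` {S. clique_independent k G S})"

definition largest_clique_independent :: "nat \<Rightarrow> 'a graph \<Rightarrow> 'a set \<Rightarrow> bool" where
  "largest_clique_independent k G S \<longleftrightarrow>
    clique_independent k G S \<and> card S = clique_independence_number k G"

definition independent_set :: "'a graph \<Rightarrow> 'a set \<Rightarrow> bool" where
  "independent_set G S \<longleftrightarrow> S \<subseteq> verts G \<and> indep S (edges G)"

definition maximum_independent_set :: "'a graph \<Rightarrow> 'a set \<Rightarrow> bool" where
  "maximum_independent_set G S \<longleftrightarrow>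
    independent_set G S \<and> (\<forall>T. independent_set G T \<longrightarrow> card T \<le> card S)"

definition uniform_weighting_on :: "'a graph \<Rightarrow> nat \<Rightarrow> 'a set \<Rightarrow> ('a \<Rightarrow> nat) \<Rightarrow> bool" where
  "uniform_weighting_on G m U w \<longleftrightarrow>
    weighting G m w \<and> U \<subseteq> verts G \<and>
    (\<forall>v\<in>verts G - U. w v = 0) \<and>
    (\<forall>u\<in>U. int (w u) \<in> {\<lfloor>real m / real (card U)\<rfloor>, \<lceil>real m / real (card U)\<rceil>})"

definition uniform_alpha :: "'a graph \<Rightarrow> nat \<Rightarrow> ('a \<Rightarrow> nat) \<Rightarrow> bool" where
  "uniform_alpha G m w \<longleftrightarrow>
    (\<exists>U. maximum_independent_set G U \<and> uniform_weighting_on G m U w)"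

definition complete_multipartite :: "'a graph \<Rightarrow> nat \<Rightarrow> (nat \<Rightarrow> 'a set) \<Rightarrow> bool" where
  "complete_multipartite G r I \<longleftrightarrow>
    simple_graph G \<and>
    verts G = (\<Union>i\<in>{1..r}. I i) \<and>
    (\<forall>i\<in>{1..r}. I i \<noteq> {}) \<and>
    (\<forall>i\<in>{1..r}. \<forall>j\<in>{1..r}. i \<noteq> j \<longrightarrow> I i \<inter> I j = {}) \<and>
    (\<forall>x y. {x, y} \<in> edges G \<longleftrightarrow>
      (\<exists>i\<in>{1..r}. \<exists>j\<in>{1..r}. i \<noteq> j \<and> x \<in> I i \<and> y \<in> I j))"

lemma simple_graph_blowup: "simple_graph G \<Longrightarrow> simple_graph (blowup G w)"
  by (auto simp: simple_graph_def blowup_def Let_def)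

end

theory Submission
  imports Defs "HOL-Library.Disjoint_Sets"
begin

text \<open>
  Let \<open>U\<close> be the maximum independent set carrying \<open>w\<close>. No part of \<open>G\<close> has more than \<open>|U|\<close>
  vertices, so the vertices of \<open>G\<close> can be coloured with the elements of \<open>U\<close> such that vertices of
  the same part get different colours. The colour classes are then cliques, and \<open>G(w')\<close> contains
  \<open>|U|\<close> disjoint cliques covering all \<open>m\<close> vertices, while \<open>G(w)\<close> consists of \<open>|U|\<close> disjoint cliques
  of balanced sizes. By convexity of \<open>n \<mapsto> n choose k\<close> the former contain at least as many
  \<open>k\<close>-cliques as the latter. The inequality is strict because \<open>S\<close> meets two parts: the colouring
  can be chosen to separate some two adjacent vertices of \<open>S\<close>, and \<open>m \<ge> k |S|\<close> leaves enough weight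
  on them for a further \<open>k\<close>-clique meeting two colour classes.
\<close>

section \<open>Convexity of binomial coefficients\<close>

text \<open>By Pascal's rule \<open>q choose j\<close> is the forward difference of
  \<open>n choose Suc j\<close> at \<open>q\<close>. These differences grow with \<open>n\<close>,
  so the line through the values at \<open>q\<close> and \<open>Suc q\<close> stays below the whole
  sequence.\<close>

lemma binomial_tangent_le:
  fixes c q j :: nat
  shows "real (q choose Suc j) + (real c - real q) * real (q choose j) \<le> real (c choose Suc j)"
proof (cases "q \<le> c")
  case True
  then show ?thesis
  proof (induction c rule: dec_induct)
    case base
    then show ?case by simp
  next
    case (step n)
    have "q choose j \<le> n choose j"
      using step.hyps by (simp add: binomial_right_mono)
    then show ?case
      using step.IH by (simp add: algebra_simps)
  qed
next
  case False
  then have "c \<le> q" by simp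
  then show ?thesis
  \<comment> \<open>Here \<open>c\<close> is fixed and the tangent point moves up, away from it;
    each move can only lower the value of the tangent line at \<open>c\<close>.\<close>
  proof (induction q rule: dec_induct)
    case base
    then show ?case by simp
  next
    case (step n)
    have "n choose j \<le> Suc n choose j"
      by (simp add: binomial_right_mono)
    then have "(real n + 1 - real c) * real (n choose j) \<le> (real n + 1 - real c) * real (Suc n choose j)"
      using step.hyps by (intro mult_left_mono) auto
    then show ?case
      using step.IH by (simp add: algebra_simps)
  qed
qed

text \<open>The tangent line at \<open>q\<close> is exact at both \<open>q\<close> and
  \<open>Suc q\<close>, hence on all values of \<open>b\<close>. Its sum over \<open>U\<close>
  depends only on the total, which \<open>b\<close> and \<open>c\<close> share, and for
  \<open>c\<close> it is a lower bound.\<close>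

lemma sum_binomial_balanced_le:
  fixes b c :: "'a \<Rightarrow> nat" and k q :: nat
  assumes "k > 0" and "\<And>u. u \<in> U \<Longrightarrow> b u \<in> {q, Suc q}" and "sum b U = sum c U"
  shows "(\<Sum>u\<in>U. b u choose k) \<le> (\<Sum>u\<in>U. c u choose k)"
proof -
  obtain j where k: "k = Suc j"
    using assms(1) gr0_conv_Suc by auto
  have "real (\<Sum>u\<in>U. b u choose k)
      = (\<Sum>u\<in>U. real (q choose k) + (real (b u) - real q) * real (q choose j))"
    unfolding of_nat_sum by (rule sum.cong) (use assms(2) k in \<open>force+\<close>)
  also have "\<dots> = (\<Sum>u\<in>U. real (q choose k)) + (real (sum b U) - (\<Sum>u\<in>U. real q)) * real (q choose j)"
    by (simp add: sum.distrib sum_subtractf flip: sum_distrib_right)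
  also have "\<dots> = (\<Sum>u\<in>U. real (q choose k) + (real (c u) - real q) * real (q choose j))"
    unfolding assms(3) by (simp add: sum.distrib sum_subtractf flip: sum_distrib_right)
  also have "\<dots> \<le> (\<Sum>u\<in>U. real (c u choose k))"
    unfolding k by (intro sum_mono binomial_tangent_le)
  finally show ?thesis
    by (simp flip: of_nat_sum)
qed

section \<open>Counting cliques in blow-ups\<close>

text \<open>Vertices over two different elements of an independent set are not adjacent, so every
  \<open>k\<close>-clique lies over a single vertex of \<open>U\<close>.\<close>

lemma num_cliques_blowup_le_sum_binomial:
  assumes "independent_set G U" and "finite U" and "k > 0"
    and "\<And>v. v \<in> verts G - U \<Longrightarrow> w v = 0"
  shows "num_cliques k (blowup G w) \<le> (\<Sum>u\<in>U. w u choose k)"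
proof -
  let ?A = "\<lambda>u. [{u} \<times> {..<w u}]\<^bsup>k\<^esup>"
  let ?C = "{K. K \<subseteq> verts (blowup G w) \<and> card K = k \<and> clique K (edges (blowup G w))}"
  have "?C \<subseteq> (\<Union>u\<in>U. ?A u)"
  proof
    fix K
    assume "K \<in> ?C"
    then have K: "K \<subseteq> (SIGMA v:verts G. {..<w v})" "card K = k"
      and cl: "clique K (edges (blowup G w))"
      by (auto simp: blowup_def)
    then obtain x where x: "x \<in> K"
      using \<open>k > 0\<close> by (metis all_not_in_conv card.empty less_irrefl)
    have inU: "fst y \<in> U" if "y \<in> K" for y
      using that K(1) assms(4)[of "fst y"] by force
    have "fst y = fst x" if y: "y \<in> K" for y
    proof (rule ccontr)
      assume ne: "fst y \<noteq> fst x"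
      then have "{y, x} \<in> edges (blowup G w)"
        using cl x y by (auto simp: clique_def)
      then have "{fst y, fst x} \<in> edges G"
        using ne by (auto simp: blowup_def Let_def doubleton_eq_iff insert_commute)
      then show False
        using assms(1) inU[OF x] inU[OF y] ne by (auto simp: independent_set_def indep_def)
    qed
    then have "K \<subseteq> {fst x} \<times> {..<w (fst x)}"
      using K(1) by force
    moreover have "finite K"
      using K(2) \<open>k > 0\<close> card_gt_0_iff by blast
    ultimately show "K \<in> (\<Union>u\<in>U. ?A u)"
      using inU[OF x] K(2) by (auto simp: nsets_def)
  qed
  moreover have "finite (\<Union>u\<in>U. ?A u)"
    using assms(2) by (simp add: finite_imp_finite_nsets)
  ultimately have "num_cliques k (blowup G w) \<le> card (\<Union>u\<in>U. ?A u)"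
    unfolding num_cliques_def by (rule card_mono[rotated])
  also have "\<dots> \<le> (\<Sum>u\<in>U. card (?A u))"
    using assms(2) by (rule card_UN_le)
  also have "\<dots> = (\<Sum>u\<in>U. w u choose k)"
    by (simp add: card_nsets card_cartesian_product)
  finally show ?thesis .
qed

text \<open>Each colour class of \<open>f\<close> is a clique, so all \<open>k\<close>-subsets of
  the blow-up over it are \<open>k\<close>-cliques. The sum counts these; a clique over two classes
  makes the bound strict.\<close>

lemma sum_binomial_less_num_cliques_blowup:
  assumes "finite (verts G)" and "finite U" and "k \<ge> 2"
    and col: "\<And>v. v \<in> verts G \<Longrightarrow> f v \<in> U"
    and adj: "\<And>u v. u \<in> verts G \<Longrightarrow> v \<in> verts G \<Longrightarrow> u \<noteq> v \<Longrightarrow> f u = f v \<Longrightarrow> {u, v} \<in> edges G"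
    and xy: "x \<in> verts G" "y \<in> verts G" "{x, y} \<in> edges G" "f x \<noteq> f y"
    and wt: "w x \<ge> k - 1" "w y > 0"
  shows "(\<Sum>u\<in>U. (\<Sum>v | v \<in> verts G \<and> f v = u. w v) choose k) < num_cliques k (blowup G w)"
proof -
  let ?V = "\<lambda>u. SIGMA v:{v \<in> verts G. f v = u}. {..<w v}"
  let ?A = "\<lambda>u. [?V u]\<^bsup>k\<^esup>"
  let ?C = "{K. K \<subseteq> verts (blowup G w) \<and> card K = k \<and> clique K (edges (blowup G w))}"
  \<comment> \<open>The extra clique: \<open>k - 1\<close> copies of \<open>x\<close> and one copy
    of \<open>y\<close>, which have different colours.\<close>
  let ?K = "insert (y, 0) ({x} \<times> {..<k - 1})"
  have verts: "verts (blowup G w) = (SIGMA v:verts G. {..<w v})"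
    by (simp add: blowup_def)
  have edge: "{p, q} \<in> edges (blowup G w)"
    if "p \<in> verts (blowup G w)" "q \<in> verts (blowup G w)" "p \<noteq> q"
      "fst p = fst q \<or> {fst p, fst q} \<in> edges G" for p q
    using that unfolding blowup_def Let_def fst_conv snd_conv by blast
  have "x \<noteq> y"
    using xy(4) by blast
  have finC: "finite ?C"
    by (rule finite_subset[of _ "Pow (verts (blowup G w))"]) (use assms(1) in \<open>auto simp: verts\<close>)
  have K: "?K \<in> ?C"
  proof -
    have sub: "?K \<subseteq> verts (blowup G w)"
      using xy wt by (auto simp: verts)
    moreover have "card ?K = k"
      using \<open>x \<noteq> y\<close> \<open>k \<ge> 2\<close> by (subst card_insert_disjoint) (auto simp: card_cartesian_product)
    moreover have "clique ?K (edges (blowup G w))"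
      unfolding clique_def
    proof (intro ballI impI)
      fix p q
      assume "p \<in> ?K" "q \<in> ?K" "p \<noteq> q"
      moreover from this have "fst p = fst q \<or> {fst p, fst q} \<in> edges G"
        using xy(3) by (auto simp: insert_commute)
      ultimately show "{p, q} \<in> edges (blowup G w)"
        using sub by (intro edge) blast+
    qed
    ultimately show ?thesis by blast
  qed
  have A: "?A u \<subseteq> ?C - {?K}" for u
  proof
    fix L
    assume "L \<in> ?A u"
    then have L: "L \<subseteq> ?V u" "card L = k"
      by (auto simp: nsets_def)
    have sub: "L \<subseteq> verts (blowup G w)"
      using L(1) by (auto simp: verts)
    have "clique L (edges (blowup G w))"
      unfolding clique_def
    proof (intro ballI impI)
      fix p q
      assume pq: "p \<in> L" "q \<in> L" "p \<noteq> q"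
      have *: "fst z \<in> verts G \<and> f (fst z) = u" if "z \<in> L" for z
        using L(1) that by auto
      have "fst p = fst q \<or> {fst p, fst q} \<in> edges G"
        using *[OF pq(1)] *[OF pq(2)] adj by metis
      with pq show "{p, q} \<in> edges (blowup G w)"
        using sub by (intro edge) blast+
    qed
    moreover have "L \<noteq> ?K"
    proof
      assume "L = ?K"
      then have "(x, 0) \<in> L" "(y, 0) \<in> L"
        using \<open>k \<ge> 2\<close> by auto
      then show False
        using L(1) xy(4) by auto
    qed
    ultimately show "L \<in> ?C - {?K}"
      using L(2) sub by blast
  qed
  have "(\<Sum>u\<in>U. (\<Sum>v | v \<in> verts G \<and> f v = u. w v) choose k) = (\<Sum>u\<in>U. card (?A u))"
    using assms(1) by (simp add: card_nsets)
  also have "\<dots> = card (\<Union>u\<in>U. ?A u)"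
  proof (rule card_UN_disjoint[symmetric])
    show "\<forall>u\<in>U. finite (?A u)"
      using assms(1) by (auto intro!: finite_imp_finite_nsets)
    show "\<forall>u\<in>U. \<forall>v\<in>U. u \<noteq> v \<longrightarrow> ?A u \<inter> ?A v = {}"
    proof (intro ballI impI equals0I)
      fix u v L
      assume "u \<noteq> v" and "L \<in> ?A u \<inter> ?A v"
      then have "L \<subseteq> ?V u \<inter> ?V v" "card L = k"
        by (auto simp: nsets_def)
      moreover have "?V u \<inter> ?V v = {}"
        using \<open>u \<noteq> v\<close> by auto
      ultimately show False
        using \<open>k \<ge> 2\<close> by simp
    qed
  qed (rule assms(2))
  also have "\<dots> \<le> card (?C - {?K})"
    using A finC by (intro card_mono) blast+
  also have "\<dots> < card ?C"
    using K finC by (intro card_Diff1_less)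
  finally show ?thesis
    unfolding num_cliques_def .
qed

section \<open>Colourings that are injective on every part\<close>

lemma ex_inj_on_prescribed:
  assumes "finite A" "finite B" "card A \<le> card B" "x \<in> A" "b \<in> B"
  shows "\<exists>g. inj_on g A \<and> g ` A \<subseteq> B \<and> g x = b"
proof -
  have "card (A - {x}) \<le> card (B - {b})"
    using assms by simp
  then obtain g where g: "g ` (A - {x}) \<subseteq> B - {b}" "inj_on g (A - {x})"
    using card_le_inj[of "A - {x}" "B - {b}"] assms by auto
  have "inj_on (g(x := b)) A"
    using g by (auto simp: inj_on_def)
  moreover have "(g(x := b)) ` A \<subseteq> B"
    using g assms(5) by auto
  ultimately show ?thesis
    by (intro exI[of _ "g(x := b)"]) simp
qed

text \<open>The parts are disjoint, so an injection into \<open>U\<close> can be chosen on each of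
  them independently and the choices glued together.\<close>

lemma ex_coloring_injective_on_parts:
  assumes "disjoint_family_on I J" and "finite U"
    and fin: "\<And>i. i \<in> J \<Longrightarrow> finite (I i)" and le: "\<And>i. i \<in> J \<Longrightarrow> card (I i) \<le> card U"
    and ij: "i \<in> J" "j \<in> J" "i \<noteq> j" "x \<in> I i" "y \<in> I j" and "b \<in> U" "c \<in> U"
  shows "\<exists>f. f ` (\<Union>l\<in>J. I l) \<subseteq> U \<and> (\<forall>l\<in>J. inj_on f (I l)) \<and> f x = b \<and> f y = c"
proof -
  have "\<forall>l\<in>J. \<exists>g. inj_on g (I l) \<and> g ` I l \<subseteq> U \<and> (l = i \<longrightarrow> g x = b) \<and> (l = j \<longrightarrow> g y = c)"
  proof
    fix l
    assume l: "l \<in> J"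
    note * = fin[OF l] \<open>finite U\<close> le[OF l]
    show "\<exists>g. inj_on g (I l) \<and> g ` I l \<subseteq> U \<and> (l = i \<longrightarrow> g x = b) \<and> (l = j \<longrightarrow> g y = c)"
      \<comment> \<open>Since \<open>i\<close> and \<open>j\<close> differ, at most one colour is
        prescribed on any part; a part other than these two needs just some injection.\<close>
      using ex_inj_on_prescribed[OF *, of x b] ex_inj_on_prescribed[OF *, of y c]
        card_le_inj[OF *] ij assms(10,11) by metis
  qed
  then obtain g where g: "\<And>l. l \<in> J \<Longrightarrow> inj_on (g l) (I l)" "\<And>l. l \<in> J \<Longrightarrow> g l ` I l \<subseteq> U"
    "g i x = b" "g j y = c"
    using ij(1,2) by (metis bchoice)
  define f where "f v = g (THE l. l \<in> J \<and> v \<in> I l) v" for v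
  have f: "f v = g l v" if "l \<in> J" "v \<in> I l" for l v
  proof -
    have "(THE l. l \<in> J \<and> v \<in> I l) = l"
      using that assms(1) by (intro the_equality) (auto simp: disjoint_family_on_def)
    then show ?thesis by (simp add: f_def)
  qed
  have "inj_on f (I l)" if "l \<in> J" for l
    using g(1)[OF that] f[OF that] by (simp cong: inj_on_cong)
  moreover have "f ` (\<Union>l\<in>J. I l) \<subseteq> U"
    using g(2) f by fastforce
  ultimately show ?thesis
    using f g(3,4) ij by (intro exI[of _ f]) auto
qed

section \<open>Adjacency and cliques in complete multipartite graphs\<close>

lemma complete_multipartite_edge_iff:
  assumes "complete_multipartite G r I" "i \<in> {1..r}" "j \<in> {1..r}" "x \<in> I i" "y \<in> I j"
  shows "{x, y} \<in> edges G \<longleftrightarrow> i \<noteq> j"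
proof -
  have *: "l = l'" if "l \<in> {1..r}" "l' \<in> {1..r}" "z \<in> I l" "z \<in> I l'" for l l' z
    using assms(1) that unfolding complete_multipartite_def by blast
  have "{x, y} \<in> edges G \<longleftrightarrow> (\<exists>i\<in>{1..r}. \<exists>j\<in>{1..r}. i \<noteq> j \<and> x \<in> I i \<and> y \<in> I j)"
    using assms(1) unfolding complete_multipartite_def by blast
  then show ?thesis
    using * assms(2-5) by metis
qed

text \<open>A clique has at most one vertex in each part, so at most two in the union of two
  parts.\<close>

lemma clique_independent_Un_parts:
  assumes G: "complete_multipartite G r I" and ij: "i \<in> {1..r}" "j \<in> {1..r}" and "k \<ge> 3"
  shows "clique_independent k G (I i \<union> I j)"
  unfolding clique_independent_def
proof (intro conjI notI)
  show "I i \<union> I j \<subseteq> verts G"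
    using G ij by (auto simp: complete_multipartite_def)
  assume "\<exists>K\<subseteq>I i \<union> I j. card K = k \<and> clique K (edges G)"
  then obtain K where K: "K \<subseteq> I i \<union> I j" "card K = k" "clique K (edges G)"
    by blast
  have "card (K \<inter> I l) \<le> 1" if "l \<in> {1..r}" for l
  proof (rule ccontr)
    assume "\<not> card (K \<inter> I l) \<le> 1"
    \<comment> \<open>An infinite set has \<open>card\<close> 0, so the negated bound also gives
      finiteness.\<close>
    then obtain x y where "x \<in> K \<inter> I l" "y \<in> K \<inter> I l" "x \<noteq> y"
      by (metis card_le_Suc0_iff_eq One_nat_def card.infinite zero_le_one)
    then show False
      using K(3) complete_multipartite_edge_iff[OF G that that, of x y] by (auto simp: clique_def)
  qed
  from this[OF ij(1)] this[OF ij(2)] have "card (K \<inter> I i) + card (K \<inter> I j) \<le> 2"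
    by linarith
  moreover have "card K \<le> card (K \<inter> I i) + card (K \<inter> I j)"
    using card_Un_le[of "K \<inter> I i" "K \<inter> I j"] K(1) by (simp add: Int_absorb2 flip: Int_Un_distrib)
  ultimately show False
    using K(2) \<open>k \<ge> 3\<close> by simp
qed

section \<open>Comparison of the two weightings\<close>

theorem theorem10:
  fixes G :: "'a graph" and I :: "nat \<Rightarrow> 'a set" and r k m :: nat
    and w w' :: "'a \<Rightarrow> nat" and S :: "'a set"
  assumes "complete_multipartite G r I"
    and "r \<ge> 2"
    and "card (I 1) > card (I 2)"
    and "\<forall>i\<in>{2..<r}. card (I i) \<ge> card (I (i + 1))"
    and "k \<ge> 3"
    and "m \<ge> k * clique_independence_number k G"
    and "uniform_alpha G m w"
    and "largest_clique_independent k G S"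
    and "uniform_weighting_on G m S w'"
  shows "num_cliques k (blowup G w) < num_cliques k (blowup G w')"
proof -
  note G = assms(1)
  have finV: "finite (verts G)" and verts: "verts G = (\<Union>i\<in>{1..r}. I i)"
    and disj: "disjoint_family_on I {1..r}"
    using G by (auto simp: complete_multipartite_def simple_graph_def disjoint_family_on_def)
  have finI: "finite (I i)" if "i \<in> {1..r}" for i
    using finV that by (auto simp: verts)
  have ne: "I i \<noteq> {}" if "i \<in> {1..r}" for i
    using G that by (auto simp: complete_multipartite_def)
  have le2: "card (I i) \<le> card (I 2)" if "2 \<le> i" "i \<le> r" for i
    using that
  proof (induction i rule: dec_induct)
    case (step n)
    then show ?case
      using assms(4) by force
  qed simp
  have le1: "card (I i) \<le> card (I 1)" if "i \<in> {1..r}" for i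
    using that le2[of i] assms(3) by (cases "i = 1") auto

  obtain U where U: "maximum_independent_set G U" and wU: "uniform_weighting_on G m U w"
    using assms(7) by (auto simp: uniform_alpha_def)
  have UV: "U \<subseteq> verts G"
    using U by (simp add: maximum_independent_set_def independent_set_def)
  then have finU: "finite U"
    using finV finite_subset by blast
  have "independent_set G (I 1)"
    using complete_multipartite_edge_iff[OF G, of 1 1] verts \<open>r \<ge> 2\<close>
    by (auto simp: independent_set_def indep_def)
  then have I1U: "card (I 1) \<le> card U"
    using U by (simp add: maximum_independent_set_def)
  have "card (I 2) > 0"
    using ne[of 2] finI[of 2] \<open>r \<ge> 2\<close> by (simp add: card_gt_0_iff)
  \<comment> \<open>The strict inequality between the two largest parts guarantees two distinct
    colours; if all parts were singletons, there would be only one.\<close>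
  then have "card U \<ge> 2"
    using assms(3) I1U by linarith
  then obtain b c where bc: "b \<in> U" "c \<in> U" "b \<noteq> c"
    by (metis card_le_Suc0_iff_eq finU not_less_eq_eq numeral_2_eq_2)

  have SV: "S \<subseteq> verts G"
    using assms(8) by (simp add: largest_clique_independent_def clique_independent_def)
  have "finite {T. clique_independent k G T}"
    by (rule finite_subset[of _ "Pow (verts G)"])
      (simp_all add: finV Collect_mono_iff Pow_def clique_independent_def)
  \<comment> \<open>This union is larger than any single part, hence so is \<open>S\<close>, which
    must therefore meet two parts.\<close>
  moreover have "clique_independent k G (I 1 \<union> I 2)"
    using clique_independent_Un_parts[OF G] \<open>r \<ge> 2\<close> \<open>k \<ge> 3\<close> by simp
  ultimately have "card (I 1 \<union> I 2) \<le> clique_independence_number k G"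
    unfolding clique_independence_number_def by (intro Max_ge) blast+
  then have "card (I 1 \<union> I 2) \<le> card S"
    using assms(8) by (simp add: largest_clique_independent_def)
  moreover have "card (I 1 \<union> I 2) = card (I 1) + card (I 2)"
    using disj finI \<open>r \<ge> 2\<close> by (intro card_Un_disjoint) (auto simp: disjoint_family_on_def)
  ultimately have cardS: "card S > card (I 1)"
    using \<open>card (I 2) > 0\<close> by linarith
  then obtain x where x: "x \<in> S"
    by fastforce
  then obtain i where i: "i \<in> {1..r}" "x \<in> I i"
    using SV verts by blast
  have "\<not> S \<subseteq> I i"
    using cardS le1[OF i(1)] card_mono[OF finI[OF i(1)], of S] by linarith
  then obtain y where y: "y \<in> S" "y \<notin> I i"
    by blast
  then obtain j where j: "j \<in> {1..r}" "y \<in> I j"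
    using SV verts by blast
  have "i \<noteq> j"
    using y j by blast
  obtain f where f: "f ` verts G \<subseteq> U" "\<And>l. l \<in> {1..r} \<Longrightarrow> inj_on f (I l)" "f x = b" "f y = c"
    using ex_coloring_injective_on_parts[OF disj finU finI order_trans[OF le1 I1U] i(1) j(1)
        \<open>i \<noteq> j\<close> i(2) j(2) bc(1,2)] unfolding verts by blast
  have adj: "{u, v} \<in> edges G" if uv: "u \<in> verts G" "v \<in> verts G" "u \<noteq> v" "f u = f v" for u v
  proof -
    obtain l l' where l: "l \<in> {1..r}" "u \<in> I l" "l' \<in> {1..r}" "v \<in> I l'"
      using uv(1,2) verts by blast
    then have "l \<noteq> l'"
      using inj_onD[OF f(2)[OF l(1)] uv(4)] uv(3) by blast
    then show ?thesis
      using complete_multipartite_edge_iff[OF G l(1,3,2,4)] by simp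
  qed
  \<comment> \<open>The average weight on \<open>S\<close> is at least the integer \<open>k\<close>,
    so rounding down keeps it at least \<open>k\<close>: enough copies of \<open>x\<close> and
    \<open>y\<close> for the extra clique.\<close>
  have w': "w' v \<ge> k" if "v \<in> S" for v
  proof -
    have "real k * real (card S) \<le> real m"
      using assms(6,8) by (simp add: largest_clique_independent_def flip: of_nat_mult)
    then have "real k \<le> real m / real (card S)"
      using cardS by (simp add: pos_le_divide_eq)
    then have "int k \<le> \<lfloor>real m / real (card S)\<rfloor>"
      by (simp add: le_floor_iff)
    moreover have "int (w' v) \<ge> \<lfloor>real m / real (card S)\<rfloor>"
      using assms(9) that floor_le_ceiling by (fastforce simp: uniform_weighting_on_def)
    ultimately show ?thesis by linarith
  qed

  define q where "q = nat \<lfloor>real m / real (card U)\<rfloor>"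
  have w: "w u \<in> {q, Suc q}" if "u \<in> U" for u
  proof -
    have "int q = \<lfloor>real m / real (card U)\<rfloor>"
      by (simp add: q_def)
    moreover have "\<lceil>real m / real (card U)\<rceil> \<in> {int q, int q + 1}"
      unfolding \<open>int q = _\<close> by (simp add: ceiling_altdef)
    ultimately show ?thesis
      using wU that by (auto simp: uniform_weighting_on_def)
  qed
  have "sum w U = sum w (verts G)"
    using wU UV finV by (intro sum.mono_neutral_left) (auto simp: uniform_weighting_on_def)
  also have "\<dots> = sum w' (verts G)"
    using wU assms(9) by (simp add: uniform_weighting_on_def weighting_def)
  \<comment> \<open>Grouping the weight by colour gives the sizes of the cliques in the second
    blow-up, with the same total \<open>m\<close> as the balanced sizes.\<close>
  also have "\<dots> = (\<Sum>u\<in>U. \<Sum>v | v \<in> verts G \<and> f v = u. w' v)"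
    by (rule sum.group[OF finV finU f(1), symmetric])
  finally have sum_eq: "sum w U = (\<Sum>u\<in>U. \<Sum>v | v \<in> verts G \<and> f v = u. w' v)" .

  have "num_cliques k (blowup G w) \<le> (\<Sum>u\<in>U. w u choose k)"
    using U wU finU \<open>k \<ge> 3\<close>
    by (intro num_cliques_blowup_le_sum_binomial)
      (auto simp: maximum_independent_set_def uniform_weighting_on_def)
  also have "\<dots> \<le> (\<Sum>u\<in>U. (\<Sum>v | v \<in> verts G \<and> f v = u. w' v) choose k)"
    by (rule sum_binomial_balanced_le[OF _ w sum_eq]) (use \<open>k \<ge> 3\<close> in simp_all)
  also have "\<dots> < num_cliques k (blowup G w')"
  proof (rule sum_binomial_less_num_cliques_blowup[OF finV finU])
    show "{x, y} \<in> edges G"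
      using complete_multipartite_edge_iff[OF G i(1) j(1) i(2) j(2)] \<open>i \<noteq> j\<close> by simp
    show "w' x \<ge> k - 1" "w' y > 0"
      using w'[OF x] w'[OF y(1)] \<open>k \<ge> 3\<close> by auto
    show "f v \<in> U" if "v \<in> verts G" for v
      using f(1) that by blast
  qed (use f(3,4) bc SV x y \<open>k \<ge> 3\<close> adj in \<open>simp_all add: subset_iff\<close>)
  finally show ?thesis .
qed

end
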